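(* Let $\mathbb{X}$ be a finite-dimensional Euclidean space, $f:\mathbb{X}\to\mathbb{R}$ continuously differentiable, $P_1,P_2:\mathbb{X}\to\mathbb{R}$ convex, $\sigma>0$, and suppose $\mathcal{F}:=\{x\in\mathbb{X}:P_1(x)-P_2(x)\le\sigma\}$ is nonempty and compact. Suppose that for every $y\in\mathcal{F}$ and $\xi\in\partial P_2(y)$ there exists $x^\odot_{(y,\xi)}\in\mathbb{X}$ with $P_1(x^\odot_{(y,\xi)})-P_2(y)-\langle\xi,x^\odot_{(y,\xi)}-y\rangle<\sigma$. Let $\{x^k\}$ be an infinite sequence generated by the away-step Frank-Wolfe-type algorithm (AFW) described in the context. Then $\{x^k\}$ is bounded and every accumulation point of $\{x^k\}$ is a stationary point of the problem $\min\{f(x):x\in\mathcal{F}\}$.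
   Context: $\partial P_i$ is the subdifferential of convex analysis; $\mathrm{bdry}\,S$ and $\mathrm{conv}(S)$ are the boundary and convex hull of $S$. For $y\in\mathcal{F}$, $\xi\in\partial P_2(y)$: $\mathcal{F}(y,\xi):=\{x\in\mathbb{X}:P_1(x)-\langle\xi,x-y\rangle-P_2(y)\le\sigma\}$. Stationary point: $x^*\in\mathbb{X}$ is a stationary point of $\min\{f(x):P_1(x)-P_2(x)\le\sigma\}$ if there exists $\lambda_*\ge0$ with $0\in\nabla f(x^* )+\lambda_*(\partial P_1(x^* )-\partial P_2(x^* ))$, $\lambda_*(P_1(x^* )-P_2(x^* )-\sigma)=0$ and $P_1(x^* )-P_2(x^* )\le\sigma$. Linear-optimization oracle: for $a\in\mathbb{X}$, $\mathcal{LO}(a,y,\xi)$ returns a solution of $\min\{\langle a,x\rangle:x\in\mathcal{F}(y,\xi)\}$. Away-step oracle: given $y\in\mathcal{F}$, $\xi\in\partial P_2(y)$ and $a\in\mathbb{X}\setminus\{0\}$, one chooses a finite set $\mathcal{S}(y,\xi)=\{v_1,\dots,v_{m_y}\}\subseteq\mathrm{bdry}\,\mathcal{F}(y,\xi)$ such that $y=\sum_{i=1}^{m_y}c_iv_i$ for some $c_1,\dots,c_{m_y}>0$ with $\sum_{i=1}^{m_y}c_i=1$, where $1\le m_y\le n+1$ and $n=\dim\mathbb{X}$. The oracle $\mathcal{AWO}(a,\mathcal{S}(y,\xi))$ returns a solution of $\max\{\langle a,x\rangle:x\in\mathrm{conv}(\mathcal{S}(y,\xi))\}$. Algorithm (AFW).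 Step 0: Choose $x^0\in\mathcal{F}$, $0<\epsilon<\zeta<\infty$, $c,\eta\in(0,1)$ and a sequence $\{\alpha_k^0\}\subseteq(0,1]$ with $\inf_k\alpha_k^0>0$. Set $k=0$. Step 1: Pick $\xi^k\in\partial P_2(x^k)$. Let $u^k_{\rm fw}$ be an output of $\mathcal{LO}(\nabla f(x^k),x^k,\xi^k)$ and set $d^k_{\rm fw}:=u^k_{\rm fw}-x^k$. If $\langle\nabla f(x^k),u^k_{\rm fw}-x^k\rangle=0$, terminate. Step 2: Choose $\mathcal{S}(x^k,\xi^k)$ as in the definition of the away-step oracle and let $u^k_{\rm aw}$ be an output of $\mathcal{AWO}(\nabla f(x^k),\mathcal{S}(x^k,\xi^k))$. Set $d^k_{\rm aw}:=x^k-u^k_{\rm aw}$ and choose an $\alpha^k_{\rm aw}\le\max\{\alpha\ge0:x^k+\alpha d^k_{\rm aw}\in\mathrm{conv}(\mathcal{S}(x^k,\xi^k))\}$. Step 3: If $\langle\nabla f(x^k),d^k_{\rm fw}\rangle>\langle\nabla f(x^k),d^k_{\rm aw}\rangle$ and $\alpha^k_{\rm aw}\in(\epsilon,\zeta]$, set $d^k=d^k_{\rm aw}$ and $\widetilde\alpha_k^0=\alpha^k_{\rm aw}$. Otherwise, set $d^k=d^k_{\rm fw}$ and $\widetilde\alpha_k^0=\alpha_k^0$. Step 4: Find $\alpha_k=\widetilde\alpha_k^0\eta^{j_k}$ with $j_k$ the smallest nonnegative integer such that $f(x^k+\alpha_kd^k)\le f(x^k)+c\alpha_k\langle\nabla f(x^k),d^k\rangle$.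 Step 5: Set $\widehat x^{k+1}=x^k+\alpha_kd^k$. Choose $x^{k+1}\in\mathcal{F}$ such that $f(x^{k+1})\le f(\widehat x^{k+1})$. Update $k\leftarrow k+1$ and go to Step 1. *)

theory Defs
  imports "HOL-Analysis.Analysis"
begin

definition subdifferential :: "('a::real_inner \<Rightarrow> real) \<Rightarrow> 'a \<Rightarrow> 'a set" where
  "subdifferential P y = {\<xi>. \<forall>x. P y + \<xi> \<bullet> (x - y) \<le> P x}"

definition feasible_set :: "('a \<Rightarrow> real) \<Rightarrow> ('a \<Rightarrow> real) \<Rightarrow> real \<Rightarrow> 'a set" where
  "feasible_set P1 P2 \<sigma> = {x. P1 x - P2 x \<le> \<sigma>}"

definition convex_approx ::
    "('a::real_inner \<Rightarrow> real) \<Rightarrow> ('a \<Rightarrow> real) \<Rightarrow> real \<Rightarrow> 'a \<Rightarrow> 'a \<Rightarrow> 'a set" where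
  "convex_approx P1 P2 \<sigma> y \<xi> = {x. P1 x - \<xi> \<bullet> (x - y) - P2 y \<le> \<sigma>}"

text \<open>The argument \<open>g\<close> is the gradient map of the objective function.\<close>

definition stationary_point ::
    "('a::real_inner \<Rightarrow> 'a) \<Rightarrow> ('a \<Rightarrow> real) \<Rightarrow> ('a \<Rightarrow> real) \<Rightarrow> real \<Rightarrow> 'a \<Rightarrow> bool" where
  "stationary_point g P1 P2 \<sigma> x \<longleftrightarrow>
     (\<exists>l::real. 0 \<le> l
        \<and> 0 \<in> {g x + l *\<^sub>R (u - v) |u v. u \<in> subdifferential P1 x \<and> v \<in> subdifferential P2 x}
        \<and> l * (P1 x - P2 x - \<sigma>) = 0
        \<and> P1 x - P2 x \<le> \<sigma>)"

definition away_set ::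
    "('a::euclidean_space \<Rightarrow> real) \<Rightarrow> ('a \<Rightarrow> real) \<Rightarrow> real \<Rightarrow> 'a \<Rightarrow> 'a \<Rightarrow> 'a set \<Rightarrow> bool" where
  "away_set P1 P2 \<sigma> y \<xi> S \<longleftrightarrow>
     finite S \<and> S \<subseteq> frontier (convex_approx P1 P2 \<sigma> y \<xi>)
     \<and> 1 \<le> card S \<and> card S \<le> DIM('a) + 1
     \<and> (\<exists>c. (\<forall>v\<in>S. 0 < c v) \<and> (\<Sum>v\<in>S. c v) = 1 \<and> y = (\<Sum>v\<in>S. c v *\<^sub>R v))"

definition armijo :: "('a::real_inner \<Rightarrow> real) \<Rightarrow> ('a \<Rightarrow> 'a) \<Rightarrow> real \<Rightarrow> 'a \<Rightarrow> 'a \<Rightarrow> real \<Rightarrow> bool" where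
  "armijo f g c x d \<alpha> \<longleftrightarrow> f (x + \<alpha> *\<^sub>R d) \<le> f x + c * \<alpha> * (g x \<bullet> d)"

text \<open>One iteration from \<open>x\<close> to \<open>x'\<close> that does not terminate; \<open>a0\<close> is the initial step size for
  the Frank-Wolfe direction. The away-step bound is a supremum in the extended reals because it is
  infinite if \<open>daw = 0\<close>; if \<open>daw \<noteq> 0\<close>, it is an attained maximum.\<close>

definition afw_step ::
    "('a::euclidean_space \<Rightarrow> real) \<Rightarrow> ('a \<Rightarrow> 'a) \<Rightarrow> ('a \<Rightarrow> real) \<Rightarrow> ('a \<Rightarrow> real) \<Rightarrow> real \<Rightarrow>
     real \<Rightarrow> real \<Rightarrow> real \<Rightarrow> real \<Rightarrow> real \<Rightarrow> 'a \<Rightarrow> 'a \<Rightarrow> bool" where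
  "afw_step f g P1 P2 \<sigma> \<epsilon> \<zeta> c \<eta> a0 x x' \<longleftrightarrow>
     (\<exists>\<xi> ufw dfw S uaw daw \<alpha>aw d \<alpha>t j \<alpha>.
        \<xi> \<in> subdifferential P2 x
        \<and> is_arg_min (\<lambda>u. g x \<bullet> u) (\<lambda>u. u \<in> convex_approx P1 P2 \<sigma> x \<xi>) ufw
        \<and> dfw = ufw - x
        \<and> g x \<bullet> (ufw - x) \<noteq> 0
        \<and> away_set P1 P2 \<sigma> x \<xi> S
        \<and> is_arg_max (\<lambda>u. g x \<bullet> u) (\<lambda>u. u \<in> convex hull S) uaw
        \<and> daw = x - uaw
        \<and> ereal \<alpha>aw \<le> (SUP \<beta>\<in>{\<beta>. 0 \<le> \<beta> \<and> x + \<beta> *\<^sub>R daw \<in> convex hull S}. ereal \<beta>)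
        \<and> (if g x \<bullet> dfw > g x \<bullet> daw \<and> \<alpha>aw \<in> {\<epsilon><..\<zeta>}
           then d = daw \<and> \<alpha>t = \<alpha>aw
           else d = dfw \<and> \<alpha>t = a0)
        \<and> armijo f g c x d (\<alpha>t * \<eta> ^ j)
        \<and> (\<forall>i<j. \<not> armijo f g c x d (\<alpha>t * \<eta> ^ i))
        \<and> \<alpha> = \<alpha>t * \<eta> ^ j
        \<and> x' \<in> feasible_set P1 P2 \<sigma>
        \<and> f x' \<le> f (x + \<alpha> *\<^sub>R d))"

definition afw_sequence ::
    "('a::euclidean_space \<Rightarrow> real) \<Rightarrow> ('a \<Rightarrow> 'a) \<Rightarrow> ('a \<Rightarrow> real) \<Rightarrow> ('a \<Rightarrow> real) \<Rightarrow> real \<Rightarrow>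
     (nat \<Rightarrow> 'a) \<Rightarrow> bool" where
  "afw_sequence f g P1 P2 \<sigma> x \<longleftrightarrow>
     (\<exists>\<epsilon> \<zeta> c \<eta> \<alpha>0.
        0 < \<epsilon> \<and> \<epsilon> < \<zeta> \<and> c \<in> {0<..<1} \<and> \<eta> \<in> {0<..<1}
        \<and> (\<forall>k. \<alpha>0 k \<in> {0<..1}) \<and> 0 < (INF k. \<alpha>0 k)
        \<and> x 0 \<in> feasible_set P1 P2 \<sigma>
        \<and> (\<forall>k. afw_step f g P1 P2 \<sigma> \<epsilon> \<zeta> c \<eta> (\<alpha>0 k) (x k) (x (Suc k))))"

definition accumulation_point :: "(nat \<Rightarrow> 'a::topological_space) \<Rightarrow> 'a \<Rightarrow> bool" where
  "accumulation_point x l \<longleftrightarrow> (\<exists>r. strict_mono r \<and> (x \<circ> r) \<longlonglongrightarrow> l)"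

end

theory Submission
  imports Defs
begin

text \<open>
  The argument has two halves: the linearized optimality gap vanishes along the iteration, and a
  point at which the limiting gap is zero is stationary.

  Vanishing gap. A subgradient inequality for \<open>P2\<close> shows that each convex approximation of the
  feasible set lies inside it, so every search direction joins two points of one compact set and
  is bounded by its diameter. Write \<open>\<gamma> k \<le> 0\<close> for the minimum of \<open>g (x k) \<bullet> (z - x k)\<close> over the
  approximation at \<open>x k\<close>. An away direction is chosen only when its slope is smaller than that
  of the Frank-Wolfe direction, so the slope of the direction used never exceeds \<open>\<gamma> k\<close>. By uniform
  continuity of the gradient, all steps below a threshold depending on \<open>\<delta>\<close> but not on \<open>k\<close> pass the Armijo
  test when the slope is at most \<open>- \<delta>\<close> (\<open>armijo_uniform\<close>). Initial steps are bounded away from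
  zero (an away step is used only if it exceeds \<open>\<epsilon>\<close>), so backtracking cannot produce short
  steps there, and each iteration with \<open>\<gamma> k \<le> - \<delta>\<close> lowers \<open>f\<close> by a fixed amount. As \<open>f\<close> is
  decreasing and bounded below along the iterates, \<open>\<gamma> k\<close> tends to zero
  (\<open>afw_sequence_gap_tendsto_0\<close>).

  Passage to the limit. Near an accumulation point \<open>l\<close> the subgradients \<open>\<xi> k\<close> are bounded, hence
  accumulate at some subgradient \<open>\<xi>'\<close> of \<open>P2\<close> at \<open>l\<close>. A point that satisfies the limiting convex
  constraint strictly also satisfies the constraint for all late \<open>k\<close> of the subsequence, and the
  Slater point makes such points dense in the limiting approximation. Thus \<open>l\<close> minimizes the linear
  functional given by the gradient over that approximation (\<open>limit_minimizes_linearization\<close>).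
  The Slater point also supplies a Lagrange multiplier \<open>m\<close> (\<open>lagrange_multiplier_exists\<close>). If \<open>m > 0\<close>, dividing by it
  turns the Lagrangian inequality into a subgradient of \<open>P1\<close>; if \<open>m = 0\<close>, the gradient vanishes
  and any subgradient of \<open>P1\<close> will do, one of which exists by \<open>subdifferential_nonempty\<close>.
\<close>

section \<open>Subgradients of finite convex functions\<close>

lemma continuous_on_convex_function:
  fixes P :: "'a::euclidean_space \<Rightarrow> real"
  assumes "convex_on UNIV P"
  shows "continuous_on UNIV P"
  using convex_on_continuous[OF open_UNIV assms] .

text \<open>
  The point \<open>(y, P y)\<close> lies outside the strict epigraph, which is convex, so a hyperplane separates
  them. Finiteness of \<open>P\<close> on the whole space forbids a vertical hyperplane, and the slope of a
  non-vertical one is a subgradient.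
\<close>

lemma subdifferential_nonempty:
  fixes P :: "'a::euclidean_space \<Rightarrow> real"
  assumes "convex_on UNIV P"
  shows "subdifferential P y \<noteq> {}"
proof -
  define E where "E = {(z, t). P z < t}"
  have "convex E"
  proof (rule convexI)
    fix p q :: "'a \<times> real" and u v :: real
    assume pq: "p \<in> E" "q \<in> E" and uv: "0 \<le> u" "0 \<le> v" "u + v = 1"
    obtain z s where p: "p = (z, s)" "P z < s" using pq(1) by (auto simp: E_def)
    obtain w t where q: "q = (w, t)" "P w < t" using pq(2) by (auto simp: E_def)
    have "P (u *\<^sub>R z + v *\<^sub>R w) \<le> u * P z + v * P w"
      using assms uv by (auto simp: convex_on_def)
    also have "\<dots> < u * s + v * t"
    proof (cases "u = 0")
      case True
      then show ?thesis using uv q by simp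
    next
      case False
      then have "u * P z < u * s" using uv p by simp
      moreover have "v * P w \<le> v * t" using uv q by (simp add: mult_left_mono)
      ultimately show ?thesis by linarith
    qed
    finally show "u *\<^sub>R p + v *\<^sub>R q \<in> E" by (simp add: E_def p q)
  qed
  moreover have "(y, P y + 1) \<in> E" "E \<inter> {(y, P y)} = {}" by (auto simp: E_def)
  ultimately obtain a b where ab: "a \<noteq> 0" "\<And>p. p \<in> E \<Longrightarrow> a \<bullet> p \<le> b" "a \<bullet> (y, P y) \<ge> b"
    using separating_hyperplane_sets[of E "{(y, P y)}"] by fastforce
  obtain p q where a: "a = (p, q)" by fastforce
  have sep: "p \<bullet> z + q * t \<le> p \<bullet> y + q * P y" if "P z < t" for z t
    using ab(2)[of "(z, t)"] ab(3) that by (auto simp: E_def a)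
  have "q \<le> 0" using sep[of y "P y + 1"] by (simp add: algebra_simps)
  \<comment> \<open>A vertical hyperplane is refuted by moving from \<open>y\<close> in its own normal direction.\<close>
  have "q \<noteq> 0"
  proof
    assume "q = 0"
    then have "p \<bullet> p \<le> 0" using sep[of "y + p" "P (y + p) + 1"] by (simp add: inner_add_right)
    then have "p = 0" by (metis inner_eq_zero_iff inner_ge_zero order_antisym)
    then show False using ab(1) a \<open>q = 0\<close> by (simp add: zero_prod_def)
  qed
  with \<open>q \<le> 0\<close> have q: "q < 0" by simp
  have "P y + ((- 1 / q) *\<^sub>R p) \<bullet> (z - y) \<le> P z" for z
  proof (rule dense_ge)
    fix t assume "P z < t"
    from sep[OF this] have "p \<bullet> (z - y) \<le> q * (P y - t)" by (simp add: algebra_simps)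
    then have "P y - t \<le> (p \<bullet> (z - y)) / q" using q by (simp add: neg_le_divide_eq mult.commute)
    then show "P y + ((- 1 / q) *\<^sub>R p) \<bullet> (z - y) \<le> t" by simp
  qed
  then have "(- 1 / q) *\<^sub>R p \<in> subdifferential P y" unfolding subdifferential_def by blast
  then show ?thesis by blast
qed

text \<open>
  Moving by one unit in the direction of \<open>\<xi>\<close> raises \<open>P\<close> by at least \<open>norm \<xi>\<close>, while \<open>P\<close> is
  bounded on the unit neighbourhood of a compact set.
\<close>

lemma bounded_subdifferential_image:
  fixes P :: "'a::euclidean_space \<Rightarrow> real"
  assumes "convex_on UNIV P" "compact K"
  shows "bounded (\<Union>y\<in>K. subdifferential P y)"
proof -
  obtain B where B: "\<And>y. y \<in> K \<Longrightarrow> norm y \<le> B"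
    using compact_imp_bounded[OF assms(2)] by (auto simp: bounded_iff)
  have "bounded (P ` cball 0 (B + 1))"
    by (intro compact_imp_bounded compact_continuous_image compact_cball
        continuous_on_subset[OF continuous_on_convex_function[OF assms(1)]]) simp
  then obtain M where M: "\<And>z. norm z \<le> B + 1 \<Longrightarrow> \<bar>P z\<bar> \<le> M"
    by (auto simp: bounded_iff) (meson mem_cball_0)
  have "norm \<xi> \<le> 2 * M" if "y \<in> K" "\<xi> \<in> subdifferential P y" for y \<xi>
  proof -
    have "norm (y + sgn \<xi>) \<le> B + 1"
      using norm_triangle_ineq[of y "sgn \<xi>"] B[OF that(1)] by (simp add: norm_sgn split: if_splits)
    then have "\<bar>P (y + sgn \<xi>)\<bar> \<le> M" by (rule M)
    moreover have "\<bar>P y\<bar> \<le> M" using B[OF that(1)] by (intro M) simp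
    moreover have "P y + \<xi> \<bullet> sgn \<xi> \<le> P (y + sgn \<xi>)"
      using that(2) by (auto simp: subdifferential_def dest: spec[of _ "y + sgn \<xi>"])
    moreover have "\<xi> \<bullet> sgn \<xi> = norm \<xi>"
      by (cases "\<xi> = 0") (simp_all add: sgn_div_norm dot_square_norm power2_eq_square)
    ultimately show ?thesis by linarith
  qed
  then show ?thesis by (auto simp: bounded_iff)
qed

lemma subdifferential_closed_graph:
  fixes P :: "'a::euclidean_space \<Rightarrow> real"
  assumes "convex_on UNIV P" "y \<longlonglongrightarrow> l" "\<xi> \<longlonglongrightarrow> \<xi>'"
    and "\<And>n. \<xi> n \<in> subdifferential P (y n)"
  shows "\<xi>' \<in> subdifferential P l"
proof -
  have "(\<lambda>n. P (y n)) \<longlonglongrightarrow> P l"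
    using continuous_on_tendsto_compose[OF continuous_on_convex_function[OF assms(1)] assms(2)] by simp
  then have "(\<lambda>n. P (y n) + \<xi> n \<bullet> (z - y n)) \<longlonglongrightarrow> P l + \<xi>' \<bullet> (z - l)" for z
    by (intro tendsto_intros assms)
  moreover have "P (y n) + \<xi> n \<bullet> (z - y n) \<le> P z" for n z
    using assms(4)[of n] by (simp add: subdifferential_def)
  ultimately have "P l + \<xi>' \<bullet> (z - l) \<le> P z" for z
    by (intro LIMSEQ_le_const2[where X = "\<lambda>n. P (y n) + \<xi> n \<bullet> (z - y n)"]) auto
  then show ?thesis by (simp add: subdifferential_def)
qed

section \<open>Multipliers for a linear objective and one convex constraint\<close>

lemma convex_on_diff_affine:
  fixes P :: "'a::real_inner \<Rightarrow> real"
  assumes "convex_on UNIV P"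
  shows "convex_on UNIV (\<lambda>z. P z - \<xi> \<bullet> (z - y) - b)"
proof (rule convex_onI)
  fix t :: real and z w :: 'a
  assume t: "0 < t" "t < 1"
  have "P ((1 - t) *\<^sub>R z + t *\<^sub>R w) \<le> (1 - t) * P z + t * P w"
    using assms t by (auto simp: convex_on_def)
  then show "P ((1 - t) *\<^sub>R z + t *\<^sub>R w) - \<xi> \<bullet> ((1 - t) *\<^sub>R z + t *\<^sub>R w - y) - b
      \<le> (1 - t) * (P z - \<xi> \<bullet> (z - y) - b) + t * (P w - \<xi> \<bullet> (w - y) - b)"
    by (simp add: algebra_simps)
qed simp

text \<open>
  A multiplier is exactly a number \<open>m \<ge> 0\<close> between the ratios \<open>- (a \<bullet> (z - l)) / h z\<close> at points with
  \<open>h z > 0\<close> and the ratios \<open>a \<bullet> (w - l) / (- h w)\<close> at points with \<open>h w < 0\<close>. Each ratio of the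
  first kind is at most each of the second: on the segment from \<open>z\<close> to \<open>w\<close> there is a point where
  the convexity bound on \<open>h\<close> is zero, and minimality there is the required inequality. The Slater
  point makes the second family nonempty, and minimality makes it nonnegative, so its infimum
  serves as \<open>m\<close>.
\<close>

lemma lagrange_multiplier_exists:
  fixes h :: "'a::real_inner \<Rightarrow> real"
  assumes h: "convex_on UNIV h" and slater: "h z0 < 0"
    and min: "\<And>z. h z \<le> 0 \<Longrightarrow> 0 \<le> a \<bullet> (z - l)"
  obtains m where "0 \<le> m" "\<And>z. 0 \<le> a \<bullet> (z - l) + m * h z"
proof -
  define Q where "Q = (\<lambda>z. a \<bullet> (z - l) / (- h z)) ` {z. h z < 0}"
  define m where "m = Inf Q"
  have Q0: "0 \<le> q" if "q \<in> Q" for q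
    using that min by (auto simp: Q_def intro!: divide_nonneg_neg)
  have ne: "Q \<noteq> {}" using slater by (auto simp: Q_def)
  have m0: "0 \<le> m" unfolding m_def by (intro cInf_greatest ne Q0)
  have "0 \<le> a \<bullet> (z - l) + m * h z" for z
  proof -
    consider "h z < 0" | "h z = 0" | "h z > 0" by linarith
    then show ?thesis
    proof cases
      case 1
      then have "a \<bullet> (z - l) / (- h z) \<in> Q" by (auto simp: Q_def)
      then have "m \<le> a \<bullet> (z - l) / (- h z)"
        unfolding m_def by (intro cInf_lower bdd_belowI[of _ 0] Q0)
      then show ?thesis using 1 by (simp add: field_simps)
    next
      case 2
      then show ?thesis using min[of z] by simp
    next
      case 3
      have "- (a \<bullet> (z - l)) / h z \<le> q" if "q \<in> Q" for q
      proof -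
        obtain w where w: "h w < 0" "q = a \<bullet> (w - l) / (- h w)" using \<open>q \<in> Q\<close> by (auto simp: Q_def)
        \<comment> \<open>The zero of the affine interpolation of \<open>h\<close> between \<open>z\<close> and \<open>w\<close>.\<close>
        define t where "t = h z / (h z - h w)"
        define v where "v = (1 - t) *\<^sub>R z + t *\<^sub>R w"
        have t: "0 \<le> t" "t \<le> 1" using w 3 by (auto simp: t_def)
        have *: "(h z - h w) * (1 - t) = - h w" "(h z - h w) * t = h z"
          using w 3 by (auto simp: t_def field_simps)
        have "h v \<le> (1 - t) * h z + t * h w"
          unfolding v_def using h t by (auto simp: convex_on_def)
        also have "\<dots> = 0" using w 3 by (simp add: t_def field_simps)
        finally have "0 \<le> a \<bullet> (v - l)" by (rule min)
        also have "a \<bullet> (v - l) = (1 - t) * (a \<bullet> (z - l)) + t * (a \<bullet> (w - l))"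
          by (simp add: v_def algebra_simps)
        finally have "0 \<le> (h z - h w) * ((1 - t) * (a \<bullet> (z - l)) + t * (a \<bullet> (w - l)))"
          using w 3 by simp
        also have "\<dots> = (- h w) * (a \<bullet> (z - l)) + h z * (a \<bullet> (w - l))"
          using * by (simp only: distrib_left mult.assoc[symmetric])
        finally have "- (a \<bullet> (z - l)) * (- h w) \<le> (a \<bullet> (w - l)) * h z" by (simp add: mult.commute)
        moreover have "0 < - h w" using w(1) by simp
        ultimately show ?thesis unfolding w(2) using 3
          by (simp only: pos_le_divide_eq times_divide_eq_left pos_divide_le_eq)
      qed
      then have "- (a \<bullet> (z - l)) / h z \<le> m" unfolding m_def by (intro cInf_greatest ne)
      then show ?thesis using 3 by (simp add: field_simps)
    qed
  qed
  with m0 show ?thesis by (rule that)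
qed

section \<open>Stationarity via the convex approximation\<close>

lemma convex_approx_subset_feasible_set:
  assumes "\<xi> \<in> subdifferential P2 y"
  shows "convex_approx P1 P2 \<sigma> y \<xi> \<subseteq> feasible_set P1 P2 \<sigma>"
proof
  fix z assume "z \<in> convex_approx P1 P2 \<sigma> y \<xi>"
  moreover have "P2 y + \<xi> \<bullet> (z - y) \<le> P2 z" using assms by (simp add: subdifferential_def)
  ultimately show "z \<in> feasible_set P1 P2 \<sigma>" by (simp add: convex_approx_def feasible_set_def)
qed

lemma convex_convex_approx:
  assumes "convex_on UNIV P1"
  shows "convex (convex_approx P1 P2 \<sigma> y \<xi>)"
proof -
  have h: "convex_on UNIV (\<lambda>z. P1 z - \<xi> \<bullet> (z - y) - P2 y)"
    using assms by (rule convex_on_diff_affine)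
  show ?thesis
    unfolding convex_approx_def convex_def
  proof (intro ballI allI impI, simp only: mem_Collect_eq)
    fix z w :: 'a and u v :: real
    assume zw: "P1 z - \<xi> \<bullet> (z - y) - P2 y \<le> \<sigma>" "P1 w - \<xi> \<bullet> (w - y) - P2 y \<le> \<sigma>"
      and uv: "0 \<le> u" "0 \<le> v" "u + v = 1"
    have "P1 (u *\<^sub>R z + v *\<^sub>R w) - \<xi> \<bullet> (u *\<^sub>R z + v *\<^sub>R w - y) - P2 y
        \<le> u * (P1 z - \<xi> \<bullet> (z - y) - P2 y) + v * (P1 w - \<xi> \<bullet> (w - y) - P2 y)"
      using h uv by (auto simp: convex_on_def)
    also have "\<dots> \<le> \<sigma>" using zw uv by (intro convex_bound_le)
    finally show "P1 (u *\<^sub>R z + v *\<^sub>R w) - \<xi> \<bullet> (u *\<^sub>R z + v *\<^sub>R w - y) - P2 y \<le> \<sigma>" .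
  qed
qed

lemma closed_convex_approx:
  fixes P1 :: "'a::euclidean_space \<Rightarrow> real"
  assumes "convex_on UNIV P1"
  shows "closed (convex_approx P1 P2 \<sigma> y \<xi>)"
  unfolding convex_approx_def
  by (intro closed_Collect_le continuous_intros continuous_on_convex_function assms)

text \<open>
  The Lagrangian \<open>g l \<bullet> (z - l) + m * h z\<close> is minimal at \<open>l\<close>, with value zero. Its optimality
  condition is the stationarity inclusion, because \<open>h\<close> is \<open>P1\<close> minus an affine function with
  slope \<open>\<xi>\<close>.
\<close>

lemma stationary_point_if_minimizes_linearization:
  fixes P1 P2 :: "'a::euclidean_space \<Rightarrow> real"
  assumes "convex_on UNIV P1"
    and l: "l \<in> feasible_set P1 P2 \<sigma>" and \<xi>: "\<xi> \<in> subdifferential P2 l"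
    and slater: "P1 z0 - P2 l - \<xi> \<bullet> (z0 - l) < \<sigma>"
    and min: "\<And>z. z \<in> convex_approx P1 P2 \<sigma> l \<xi> \<Longrightarrow> 0 \<le> g l \<bullet> (z - l)"
  shows "stationary_point g P1 P2 \<sigma> l"
proof -
  define h where "h = (\<lambda>z. P1 z - \<xi> \<bullet> (z - l) - (P2 l + \<sigma>))"
  have "convex_on UNIV h" unfolding h_def by (rule convex_on_diff_affine[OF assms(1)])
  moreover have "h z0 < 0" using slater by (simp add: h_def)
  moreover have "0 \<le> g l \<bullet> (z - l)" if "h z \<le> 0" for z
    using that by (intro min) (simp add: h_def convex_approx_def)
  ultimately obtain m where m: "0 \<le> m" "\<And>z. 0 \<le> g l \<bullet> (z - l) + m * h z"
    using lagrange_multiplier_exists by blast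
  have hl: "h l = P1 l - P2 l - \<sigma>" "h l \<le> 0"
    using l by (auto simp: h_def feasible_set_def)
  have compl: "m * h l = 0"
    using m(2)[of l] mult_nonneg_nonpos[OF m(1) hl(2)] by simp
  obtain u where u: "u \<in> subdifferential P1 l" "g l + m *\<^sub>R (u - \<xi>) = 0"
  proof (cases "m = 0")
    case True
    then have "g l \<bullet> (- g l) \<ge> 0" using m(2)[of "l - g l"] by simp
    then have "g l = 0" by (metis inner_eq_zero_iff inner_ge_zero inner_minus_right neg_0_le_iff_le order_antisym)
    moreover obtain u where "u \<in> subdifferential P1 l"
      using subdifferential_nonempty[OF assms(1)] by blast
    ultimately show ?thesis using True that by simp
  next
    case False
    define u where "u = \<xi> - (1 / m) *\<^sub>R g l"
    have "P1 l + u \<bullet> (z - l) \<le> P1 z" for z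
    proof -
      have "m * h l \<le> g l \<bullet> (z - l) + m * h z" using compl m(2)[of z] by linarith
      also have "\<dots> = m * (h z + (1 / m) * (g l \<bullet> (z - l)))" using False by (simp add: algebra_simps)
      finally have "h l \<le> h z + (1 / m) * (g l \<bullet> (z - l))"
        using False m(1) by (simp only: mult_le_cancel_left)
      then show ?thesis by (simp add: h_def u_def inner_diff_left)
    qed
    then have "u \<in> subdifferential P1 l" by (simp add: subdifferential_def)
    moreover have "g l + m *\<^sub>R (u - \<xi>) = 0" using False by (simp add: u_def)
    ultimately show ?thesis by (rule that)
  qed
  then have "0 \<in> {g l + m *\<^sub>R (u - v) |u v. u \<in> subdifferential P1 l \<and> v \<in> subdifferential P2 l}"
    using \<xi> by (intro CollectI exI[of _ u] exI[of _ \<xi>]) simp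
  moreover have "P1 l - P2 l \<le> \<sigma>" using hl by simp
  ultimately show ?thesis
    unfolding stationary_point_def using m(1) compl[unfolded hl(1)] by blast
qed

text \<open>
  A point \<open>z\<close> of the limiting approximation need not belong to any of the approximations at
  \<open>y n\<close>. Points with strict inequality eventually do, so the inequality passes to the limit
  for them; an arbitrary \<open>z\<close> is reached along the segment towards the Slater point, whose points
  other than \<open>z\<close> are strict.
\<close>

lemma limit_minimizes_linearization:
  fixes P1 P2 :: "'a::euclidean_space \<Rightarrow> real"
  assumes cvx: "convex_on UNIV P1" "convex_on UNIV P2"
    and lim: "y \<longlonglongrightarrow> l" "\<xi> \<longlonglongrightarrow> \<xi>'" "a \<longlonglongrightarrow> a'" "\<gamma> \<longlonglongrightarrow> 0"
    and min: "\<And>n z. z \<in> convex_approx P1 P2 \<sigma> (y n) (\<xi> n) \<Longrightarrow> \<gamma> n \<le> a n \<bullet> (z - y n)"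
    and slater: "P1 z0 - P2 l - \<xi>' \<bullet> (z0 - l) < \<sigma>"
    and z: "z \<in> convex_approx P1 P2 \<sigma> l \<xi>'"
  shows "0 \<le> a' \<bullet> (z - l)"
proof -
  define h where "h = (\<lambda>z. P1 z - \<xi>' \<bullet> (z - l) - (P2 l + \<sigma>))"
  have h: "convex_on UNIV h" unfolding h_def by (rule convex_on_diff_affine[OF cvx(1)])
  have strict: "0 \<le> a' \<bullet> (w - l)" if "h w < 0" for w
  proof -
    have "(\<lambda>n. P2 (y n)) \<longlonglongrightarrow> P2 l"
      using continuous_on_tendsto_compose[OF continuous_on_convex_function[OF cvx(2)] lim(1)] by simp
    then have "(\<lambda>n. P1 w - \<xi> n \<bullet> (w - y n) - P2 (y n)) \<longlonglongrightarrow> P1 w - \<xi>' \<bullet> (w - l) - P2 l"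
      by (intro tendsto_intros lim)
    then have "\<forall>\<^sub>F n in sequentially. P1 w - \<xi> n \<bullet> (w - y n) - P2 (y n) < \<sigma>"
      by (rule order_tendstoD(2)) (use that in \<open>simp add: h_def\<close>)
    then have "\<forall>\<^sub>F n in sequentially. \<gamma> n \<le> a n \<bullet> (w - y n)"
      by eventually_elim (simp add: min convex_approx_def)
    moreover have "(\<lambda>n. a n \<bullet> (w - y n)) \<longlonglongrightarrow> a' \<bullet> (w - l)"
      by (intro tendsto_intros lim)
    ultimately show ?thesis by (intro tendsto_le[OF sequentially_bot _ lim(4)])
  qed
  have "\<forall>\<^sub>F t in at_right 0. 0 \<le> a' \<bullet> (((1 - t) *\<^sub>R z + t *\<^sub>R z0) - l)"
  proof (rule eventually_at_right_less[THEN eventually_mp[rotated]])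
    show "\<forall>\<^sub>F t in at_right (0::real). 0 < t \<longrightarrow> 0 \<le> a' \<bullet> (((1 - t) *\<^sub>R z + t *\<^sub>R z0) - l)"
    proof (rule eventually_at_rightI[of _ 1])
      fix t :: real assume t: "t \<in> {0<..<1}"
      have "h ((1 - t) *\<^sub>R z + t *\<^sub>R z0) \<le> (1 - t) * h z + t * h z0"
        using h t by (auto simp: convex_on_def)
      also have "\<dots> < 0"
      proof -
        have "(1 - t) * h z \<le> 0" using t z by (intro mult_nonneg_nonpos) (auto simp: h_def convex_approx_def)
        moreover have "t * h z0 < 0" using t slater by (intro mult_pos_neg) (auto simp: h_def)
        ultimately show ?thesis by linarith
      qed
      finally show "0 < t \<longrightarrow> 0 \<le> a' \<bullet> (((1 - t) *\<^sub>R z + t *\<^sub>R z0) - l)" using strict by blast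
    qed simp
  qed
  moreover have "((\<lambda>t. a' \<bullet> (((1 - t) *\<^sub>R z + t *\<^sub>R z0) - l)) \<longlongrightarrow> a' \<bullet> (((1 - 0) *\<^sub>R z + 0 *\<^sub>R z0) - l)) (at_right 0)"
    by (intro tendsto_intros)
  ultimately have "0 \<le> a' \<bullet> (((1 - 0) *\<^sub>R z + 0 *\<^sub>R z0) - l)"
    by (intro tendsto_lowerbound[where F = "at_right (0::real)"]) auto
  then show ?thesis by simp
qed

section \<open>Sufficient decrease along the iteration\<close>

text \<open>
  By the mean value theorem a direction of slope at most \<open>- \<delta>\<close> can fail the test at \<open>t\<close> only if the slope along \<open>d\<close> changes by more
  than \<open>(1 - c) * \<delta>\<close> within distance \<open>t * norm d\<close> of \<open>x\<close>. Uniform continuity of the gradient on a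
  bounded neighbourhood of \<open>K\<close> excludes this for small \<open>t\<close>, independently of \<open>x\<close> and \<open>d\<close>.
\<close>

lemma armijo_uniform:
  fixes f :: "'a::euclidean_space \<Rightarrow> real"
  assumes grad: "\<And>y. GDERIV f y :> g y" and cont: "continuous_on UNIV g"
    and "bounded K" and "c < 1" and "0 < \<delta>"
  obtains \<tau> where "0 < \<tau>"
    "\<And>x d t. x \<in> K \<Longrightarrow> norm d \<le> D \<Longrightarrow> g x \<bullet> d \<le> - \<delta> \<Longrightarrow> 0 \<le> t \<Longrightarrow> t \<le> \<tau> \<Longrightarrow> armijo f g c x d t"
proof -
  \<comment> \<open>A strictly positive bound on the directions, since \<open>D\<close> may be zero and \<open>C\<close> is divided by.\<close>
  define C where "C = \<bar>D\<bar> + 1"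
  obtain B where B: "\<And>x. x \<in> K \<Longrightarrow> norm x \<le> B" using \<open>bounded K\<close> by (auto simp: bounded_iff)
  have "uniformly_continuous_on (cball 0 (B + C)) g"
    by (intro compact_uniformly_continuous continuous_on_subset[OF cont]) auto
  moreover have C: "C > 0" and "(1 - c) * \<delta> / C > 0" using assms by (auto simp: C_def)
  ultimately obtain e where e: "e > 0"
    "\<And>v w. norm v \<le> B + C \<Longrightarrow> norm w \<le> B + C \<Longrightarrow> dist w v < e \<Longrightarrow> dist (g w) (g v) < (1 - c) * \<delta> / C"
    unfolding uniformly_continuous_on_def by (metis mem_cball_0)
  \<comment> \<open>The bound \<open>1\<close> keeps \<open>x + t *\<^sub>R d\<close> in the ball where \<open>g\<close> is uniformly continuous; the other
    bound keeps it within \<open>e\<close> of \<open>x\<close>.\<close>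
  define \<tau> where "\<tau> = min 1 (e / (2 * C))"
  show ?thesis
  proof (rule that[of \<tau>])
    show "0 < \<tau>" using e C by (simp add: \<tau>_def)
  next
    fix x d t assume x: "x \<in> K" and d: "norm d \<le> D" "g x \<bullet> d \<le> - \<delta>" and t: "0 \<le> t" "t \<le> \<tau>"
    have dC: "norm d \<le> C" using d by (simp add: C_def)
    show "armijo f g c x d t"
    proof (cases "t = 0")
      case True
      then show ?thesis by (simp add: armijo_def)
    next
      case False
      with t have t0: "0 < t" by simp
      have der: "((\<lambda>s. f (x + s *\<^sub>R d)) has_real_derivative g (x + s *\<^sub>R d) \<bullet> d) (at s)" for s
      proof -
        have "(f has_derivative (\<lambda>h. h \<bullet> g (x + s *\<^sub>R d))) (at (x + s *\<^sub>R d))"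
          using grad by (simp add: gderiv_def)
        moreover have "((\<lambda>s. x + s *\<^sub>R d) has_derivative (\<lambda>h. h *\<^sub>R d)) (at s)"
          by (auto intro!: derivative_eq_intros)
        ultimately have "((\<lambda>s. f (x + s *\<^sub>R d)) has_derivative (\<lambda>h. (h *\<^sub>R d) \<bullet> g (x + s *\<^sub>R d))) (at s)"
          by (rule has_derivative_compose[rotated])
        then show ?thesis
          by (simp add: has_field_derivative_def inner_commute mult.commute[of _ "_ \<bullet> _"])
      qed
      from MVT2[OF t0 der]
      obtain s where s: "0 < s" "s < t"
        "f (x + t *\<^sub>R d) - f (x + 0 *\<^sub>R d) = (t - 0) * (g (x + s *\<^sub>R d) \<bullet> d)"
        by blast
      have "s * norm d \<le> \<tau> * C" using s t dC C by (intro mult_mono) auto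
      moreover have "\<tau> * C \<le> C" using C by (simp add: \<tau>_def mult_le_cancel_right1)
      moreover have "\<tau> * C < e"
      proof -
        have "\<tau> * C \<le> e / (2 * C) * C" using C by (intro mult_right_mono) (auto simp: \<tau>_def)
        also have "\<dots> < e" using C e by simp
        finally show ?thesis .
      qed
      ultimately have sd: "s * norm d \<le> C" "s * norm d < e" by auto
      have "norm (x + s *\<^sub>R d) \<le> B + C"
        using norm_triangle_ineq[of x "s *\<^sub>R d"] B[OF x] sd s by simp
      moreover have "norm x \<le> B + C" using B[OF x] C by simp
      ultimately have "dist (g (x + s *\<^sub>R d)) (g x) < (1 - c) * \<delta> / C"
        using sd s by (intro e) (auto simp: dist_norm)
      then have "norm (g (x + s *\<^sub>R d) - g x) * norm d \<le> (1 - c) * \<delta> / C * C"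
        using dC C assms(4,5)
        by (intro mult_mono) (auto simp: dist_norm intro!: divide_nonneg_pos mult_nonneg_nonneg)
      then have "(g (x + s *\<^sub>R d) - g x) \<bullet> d \<le> (1 - c) * \<delta>"
        using norm_cauchy_schwarz[of "g (x + s *\<^sub>R d) - g x" d] C by simp
      also have "\<dots> \<le> (1 - c) * - (g x \<bullet> d)" using d assms by (intro mult_left_mono) auto
      finally have "g (x + s *\<^sub>R d) \<bullet> d \<le> c * (g x \<bullet> d)" by (simp add: algebra_simps)
      then have "t * (g (x + s *\<^sub>R d) \<bullet> d) \<le> t * (c * (g x \<bullet> d))" using t0 by simp
      then show ?thesis using s(3) by (simp add: armijo_def algebra_simps)
    qed
  qed
qed

text \<open>
  Unless the initial step \<open>a\<close> is accepted, the trial step before the accepted one was rejected, hence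
  larger than \<open>\<tau>\<close>.
\<close>

lemma backtracking_step_lower_bound:
  fixes \<eta> :: real
  assumes "0 < \<eta>" "\<And>i. i < j \<Longrightarrow> \<not> Q (a * \<eta> ^ i)" "0 \<le> a" "\<And>t. 0 \<le> t \<Longrightarrow> t \<le> \<tau> \<Longrightarrow> Q t"
  shows "min a (\<eta> * \<tau>) \<le> a * \<eta> ^ j"
proof (cases j)
  case (Suc i)
  then have "\<not> a * \<eta> ^ i \<le> \<tau>" using assms(2)[of i] assms(1,3) assms(4)[of "a * \<eta> ^ i"] by auto
  then have "\<eta> * \<tau> \<le> \<eta> * (a * \<eta> ^ i)" using assms(1) by simp
  then show ?thesis by (simp add: Suc algebra_simps)
qed simp

text \<open>
  What both kinds of step have in common: the direction descends at least as fast as the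
  Frank-Wolfe direction and, joining two feasible points, is no longer than the diameter of the
  feasible set; the initial step is at least \<open>min \<epsilon> a0\<close>. The last conclusion quantifies over \<open>\<tau>\<close>
  so that the direction and the step can be fixed before the required decrease rate is chosen.
\<close>

lemma afw_step_progress:
  fixes P1 P2 :: "'a::euclidean_space \<Rightarrow> real"
  assumes P1: "convex_on UNIV P1" and F: "bounded (feasible_set P1 P2 \<sigma>)"
    and x: "x \<in> feasible_set P1 P2 \<sigma>"
    and par: "0 < \<epsilon>" "0 < \<eta>" "0 < a0"
    and step: "afw_step f g P1 P2 \<sigma> \<epsilon> \<zeta> c \<eta> a0 x x'"
  obtains \<xi> u d \<alpha> where
    "\<xi> \<in> subdifferential P2 x"
    "\<And>z. z \<in> convex_approx P1 P2 \<sigma> x \<xi> \<Longrightarrow> g x \<bullet> (u - x) \<le> g x \<bullet> (z - x)"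
    "g x \<bullet> (u - x) \<le> 0" "g x \<bullet> d \<le> g x \<bullet> (u - x)" "norm d \<le> diameter (feasible_set P1 P2 \<sigma>)"
    "0 < \<alpha>" "f x' \<le> f x + c * \<alpha> * (g x \<bullet> d)"
    "\<And>\<tau>. (\<And>t. 0 \<le> t \<Longrightarrow> t \<le> \<tau> \<Longrightarrow> armijo f g c x d t) \<Longrightarrow> min (min \<epsilon> a0) (\<eta> * \<tau>) \<le> \<alpha>"
proof -
  from step obtain \<xi> u S v d \<alpha>' s j where
    \<xi>: "\<xi> \<in> subdifferential P2 x"
    and u: "is_arg_min (\<lambda>u. g x \<bullet> u) (\<lambda>u. u \<in> convex_approx P1 P2 \<sigma> x \<xi>) u"
    and S: "away_set P1 P2 \<sigma> x \<xi> S"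
    and v: "is_arg_max (\<lambda>u. g x \<bullet> u) (\<lambda>u. u \<in> convex hull S) v"
    and choice: "if g x \<bullet> (u - x) > g x \<bullet> (x - v) \<and> \<alpha>' \<in> {\<epsilon><..\<zeta>}
           then d = x - v \<and> s = \<alpha>' else d = u - x \<and> s = a0"
    and arm: "armijo f g c x d (s * \<eta> ^ j)" "\<And>i. i < j \<Longrightarrow> \<not> armijo f g c x d (s * \<eta> ^ i)"
    and x': "f x' \<le> f (x + (s * \<eta> ^ j) *\<^sub>R d)"
    unfolding afw_step_def by blast
  let ?A = "convex_approx P1 P2 \<sigma> x \<xi>" and ?F = "feasible_set P1 P2 \<sigma>"
  have sub: "?A \<subseteq> ?F" using \<xi> by (rule convex_approx_subset_feasible_set)
  have "S \<subseteq> ?A"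
    using S closed_convex_approx[OF P1, of P2 \<sigma> x \<xi>] frontier_subset_closed
    by (auto simp: away_set_def)
  then have "convex hull S \<subseteq> ?A" by (intro hull_minimal convex_convex_approx P1)
  then have vF: "v \<in> ?F" using v sub by (auto simp: is_arg_max_def)
  have uF: "u \<in> ?F" using u sub by (auto simp: is_arg_min_def)
  have min: "g x \<bullet> (u - x) \<le> g x \<bullet> (z - x)" if "z \<in> ?A" for z
    using u that by (auto simp: is_arg_min_def inner_diff_right not_less)
  have "x \<in> ?A" using x by (simp add: convex_approx_def feasible_set_def)
  then have u0: "g x \<bullet> (u - x) \<le> 0" using min[of x] by simp
  have d: "g x \<bullet> d \<le> g x \<bullet> (u - x)" using choice by (auto split: if_splits)
  have nd: "norm d \<le> diameter ?F"
    using choice diameter_bounded_bound[OF F uF x] diameter_bounded_bound[OF F x vF]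
    by (auto simp: dist_norm split: if_splits)
  have s: "min \<epsilon> a0 \<le> s" using choice by (auto split: if_splits)
  have s0: "0 < s" using s par by simp
  show ?thesis
  proof (rule that[of \<xi> u d "s * \<eta> ^ j"])
    show "0 < s * \<eta> ^ j" using s0 par by simp
    show "f x' \<le> f x + c * (s * \<eta> ^ j) * (g x \<bullet> d)" using arm(1) x' by (simp add: armijo_def)
    show "min (min \<epsilon> a0) (\<eta> * \<tau>) \<le> s * \<eta> ^ j"
      if "\<And>t. 0 \<le> t \<Longrightarrow> t \<le> \<tau> \<Longrightarrow> armijo f g c x d t" for \<tau>
      using backtracking_step_lower_bound[of \<eta> j "armijo f g c x d" s \<tau>] par(2) arm(2) s0 s that by simp
  qed (use \<xi> min u0 d nd in auto)
qed

lemma afw_sequence_feasible: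
  assumes "afw_sequence f g P1 P2 \<sigma> x"
  shows "x k \<in> feasible_set P1 P2 \<sigma>"
  using assms by (cases k) (auto simp: afw_sequence_def afw_step_def)

text \<open>
  The witness for \<open>\<gamma> k\<close> is the slope of the Frank-Wolfe direction. An
  iteration with \<open>\<gamma> k \<le> - \<delta>\<close> would lower \<open>f\<close> by at least \<open>c * m * \<delta>\<close>, where \<open>m\<close> bounds the
  accepted step from below, but the decrements of \<open>f\<close> tend to zero.
\<close>

lemma afw_sequence_gap_tendsto_0:
  fixes f P1 P2 :: "'a::euclidean_space \<Rightarrow> real"
  assumes grad: "\<And>y. GDERIV f y :> g y" and cont: "continuous_on UNIV g"
    and P1: "convex_on UNIV P1" and F: "compact (feasible_set P1 P2 \<sigma>)"
    and seq: "afw_sequence f g P1 P2 \<sigma> x"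
  obtains \<xi> \<gamma> where "\<And>k. \<xi> k \<in> subdifferential P2 (x k)" "\<gamma> \<longlonglongrightarrow> 0"
    "\<And>k z. z \<in> convex_approx P1 P2 \<sigma> (x k) (\<xi> k) \<Longrightarrow> \<gamma> k \<le> g (x k) \<bullet> (z - x k)"
proof -
  let ?F = "feasible_set P1 P2 \<sigma>"
  from seq obtain \<epsilon> \<zeta> c \<eta> \<alpha>0 where
    par: "0 < \<epsilon>" "c \<in> {0<..<1}" "\<eta> \<in> {0<..<1}" "\<And>k. \<alpha>0 k \<in> {0<..1}" "0 < (INF k. \<alpha>0 k)"
    and step: "\<And>k. afw_step f g P1 P2 \<sigma> \<epsilon> \<zeta> c \<eta> (\<alpha>0 k) (x k) (x (Suc k))"
    unfolding afw_sequence_def by blast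
  have xF: "x k \<in> ?F" for k by (rule afw_sequence_feasible[OF seq])
  have bF: "bounded ?F" using F by (rule compact_imp_bounded)
  define \<alpha>min where "\<alpha>min = min \<epsilon> (INF k. \<alpha>0 k)"
  have \<alpha>min: "0 < \<alpha>min" "\<And>k. \<alpha>min \<le> min \<epsilon> (\<alpha>0 k)"
  proof -
    have "(INF k. \<alpha>0 k) \<le> \<alpha>0 k" for k
      using par(4) by (intro cINF_lower bdd_belowI2[of _ 0]) (auto simp: less_imp_le)
    then show "\<And>k. \<alpha>min \<le> min \<epsilon> (\<alpha>0 k)" by (auto simp: \<alpha>min_def min_le_iff_disj)
    show "0 < \<alpha>min" using par by (simp add: \<alpha>min_def)
  qed
  have "\<exists>\<xi> u d \<alpha>. \<xi> \<in> subdifferential P2 (x k) \<and>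
     (\<forall>z \<in> convex_approx P1 P2 \<sigma> (x k) \<xi>. g (x k) \<bullet> (u - x k) \<le> g (x k) \<bullet> (z - x k)) \<and>
     g (x k) \<bullet> (u - x k) \<le> 0 \<and> g (x k) \<bullet> d \<le> g (x k) \<bullet> (u - x k) \<and> norm d \<le> diameter ?F \<and>
     0 < \<alpha> \<and> f (x (Suc k)) \<le> f (x k) + c * \<alpha> * (g (x k) \<bullet> d) \<and>
     (\<forall>\<tau>. (\<forall>t. 0 \<le> t \<longrightarrow> t \<le> \<tau> \<longrightarrow> armijo f g c (x k) d t) \<longrightarrow> min (min \<epsilon> (\<alpha>0 k)) (\<eta> * \<tau>) \<le> \<alpha>)" for k
    by (rule afw_step_progress[OF P1 bF xF par(1) _ _ step[of k]]) (use par(3,4) in \<open>auto; blast\<close>)+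
  then obtain \<xi> u d \<alpha> where
    \<xi>: "\<And>k. \<xi> k \<in> subdifferential P2 (x k)"
    and min: "\<And>k z. z \<in> convex_approx P1 P2 \<sigma> (x k) (\<xi> k) \<Longrightarrow> g (x k) \<bullet> (u k - x k) \<le> g (x k) \<bullet> (z - x k)"
    and gap: "\<And>k. g (x k) \<bullet> (u k - x k) \<le> 0" "\<And>k. g (x k) \<bullet> d k \<le> g (x k) \<bullet> (u k - x k)"
    and nd: "\<And>k. norm (d k) \<le> diameter ?F"
    and dec: "\<And>k. 0 < \<alpha> k" "\<And>k. f (x (Suc k)) \<le> f (x k) + c * \<alpha> k * (g (x k) \<bullet> d k)"
    and long: "\<And>k \<tau>. (\<And>t. 0 \<le> t \<Longrightarrow> t \<le> \<tau> \<Longrightarrow> armijo f g c (x k) (d k) t)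
      \<Longrightarrow> min (min \<epsilon> (\<alpha>0 k)) (\<eta> * \<tau>) \<le> \<alpha> k"
    by metis
  have "decseq (\<lambda>k. f (x k))"
  proof (rule decseq_SucI)
    fix k
    have "c * \<alpha> k * (g (x k) \<bullet> d k) \<le> 0"
      using gap(1,2)[of k] dec(1)[of k] par(2) by (intro mult_nonneg_nonpos) auto
    then show "f (x (Suc k)) \<le> f (x k)" using dec(2)[of k] by linarith
  qed
  moreover have "bounded (f ` ?F)"
  proof -
    have "continuous_on UNIV f"
      by (intro continuous_at_imp_continuous_on ballI)
         (rule has_derivative_continuous[OF grad[unfolded gderiv_def]])
    then show ?thesis
      by (intro compact_imp_bounded compact_continuous_image F) (rule continuous_on_subset, auto)
  qed
  then obtain M where "\<And>k. \<bar>f (x k)\<bar> \<le> M" using xF by (fastforce simp: bounded_iff)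
  then have "\<And>k. - M \<le> f (x k)" by (metis abs_le_D2 minus_le_iff)
  ultimately obtain L where "(\<lambda>k. f (x k)) \<longlonglongrightarrow> L" using decseq_convergent by blast
  then have diff: "(\<lambda>k. f (x k) - f (x (Suc k))) \<longlonglongrightarrow> L - L"
    by (intro tendsto_diff LIMSEQ_Suc)
  have "(\<lambda>k. g (x k) \<bullet> (u k - x k)) \<longlonglongrightarrow> 0"
  proof (rule order_tendstoI)
    fix \<delta>' :: real assume "\<delta>' < 0"
    define \<delta> where "\<delta> = - \<delta>'"
    obtain \<tau> where \<tau>: "0 < \<tau>"
      "\<And>y e t. y \<in> ?F \<Longrightarrow> norm e \<le> diameter ?F \<Longrightarrow> g y \<bullet> e \<le> - \<delta> \<Longrightarrow> 0 \<le> t \<Longrightarrow> t \<le> \<tau> \<Longrightarrow> armijo f g c y e t"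
      using armijo_uniform[OF grad cont bF, of c \<delta> "diameter ?F"] par(2) \<open>\<delta>' < 0\<close> by (auto simp: \<delta>_def)
    define m where "m = min \<alpha>min (\<eta> * \<tau>)"
    have m: "0 < m" using \<alpha>min \<tau> par by (simp add: m_def)
    have \<delta>: "0 < \<delta>" using \<open>\<delta>' < 0\<close> by (simp add: \<delta>_def)
    have "\<forall>\<^sub>F k in sequentially. f (x k) - f (x (Suc k)) < c * m * \<delta>"
      using m par \<delta> by (intro order_tendstoD(2)[OF diff]) auto
    then show "\<forall>\<^sub>F k in sequentially. \<delta>' < g (x k) \<bullet> (u k - x k)"
    proof eventually_elim
      case (elim k)
      show ?case
      proof (rule ccontr)
        assume "\<not> ?thesis"
        then have gd: "g (x k) \<bullet> d k \<le> - \<delta>" using gap(2)[of k] by (simp add: \<delta>_def)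
        have "min (min \<epsilon> (\<alpha>0 k)) (\<eta> * \<tau>) \<le> \<alpha> k" by (intro long \<tau>(2)[OF xF nd gd])
        then have "m \<le> \<alpha> k" using \<alpha>min(2)[of k] unfolding m_def by linarith
        then have "c * m * \<delta> \<le> c * \<alpha> k * - (g (x k) \<bullet> d k)"
          using par(2) m \<delta> gd by (intro mult_mono) auto
        then show False using dec(2)[of k] elim by simp
      qed
    qed
  next
    fix b :: real assume "0 < b"
    then show "\<forall>\<^sub>F k in sequentially. g (x k) \<bullet> (u k - x k) < b"
      using gap(1) by (intro always_eventually allI) (rule le_less_trans)
  qed
  then show ?thesis using \<xi> min by (intro that[of \<xi> "\<lambda>k. g (x k) \<bullet> (u k - x k)"])
qed

section \<open>Accumulation points are stationary\<close>

theorem theorem6: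
  fixes f P1 P2 :: "'a::euclidean_space \<Rightarrow> real"
    and grad :: "'a \<Rightarrow> 'a"
    and \<sigma> :: real
    and x :: "nat \<Rightarrow> 'a"
  assumes "\<And>y. GDERIV f y :> grad y"
    and "continuous_on UNIV grad"
    and "convex_on UNIV P1"
    and "convex_on UNIV P2"
    and "\<sigma> > 0"
    and "feasible_set P1 P2 \<sigma> \<noteq> {}"
    and "compact (feasible_set P1 P2 \<sigma>)"
    and "\<And>y \<xi>. y \<in> feasible_set P1 P2 \<sigma> \<Longrightarrow> \<xi> \<in> subdifferential P2 y \<Longrightarrow>
           \<exists>z. P1 z - P2 y - \<xi> \<bullet> (z - y) < \<sigma>"
    and "afw_sequence f grad P1 P2 \<sigma> x"
  shows "bounded (range x) \<and>
         (\<forall>l. accumulation_point x l \<longrightarrow> stationary_point grad P1 P2 \<sigma> l)"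
proof (intro conjI allI impI)
  have xF: "x k \<in> feasible_set P1 P2 \<sigma>" for k by (rule afw_sequence_feasible[OF assms(9)])
  then show "bounded (range x)"
    using compact_imp_bounded[OF assms(7)] by (rule_tac bounded_subset) auto
  fix l assume "accumulation_point x l"
  then obtain r where r: "strict_mono r" "(x \<circ> r) \<longlonglongrightarrow> l" by (auto simp: accumulation_point_def)
  have l: "l \<in> feasible_set P1 P2 \<sigma>"
    using closed_sequentially[OF compact_imp_closed[OF assms(7)] _ r(2)] xF by simp
  obtain \<xi> \<gamma> where \<xi>: "\<And>k. \<xi> k \<in> subdifferential P2 (x k)" and \<gamma>: "\<gamma> \<longlonglongrightarrow> 0"
    and min: "\<And>k z. z \<in> convex_approx P1 P2 \<sigma> (x k) (\<xi> k) \<Longrightarrow> \<gamma> k \<le> grad (x k) \<bullet> (z - x k)"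
    using afw_sequence_gap_tendsto_0[OF assms(1-3,7,9)] by blast
  have "bounded (range (\<xi> \<circ> r))"
    by (rule bounded_subset[OF bounded_subdifferential_image[OF assms(4,7)]]) (use \<xi> xF in auto)
  then obtain \<xi>' q where q: "strict_mono q" "(\<xi> \<circ> r \<circ> q) \<longlonglongrightarrow> \<xi>'"
    using bounded_imp_convergent_subsequence by blast
  define s where "s = r \<circ> q"
  have s: "strict_mono s" using r(1) q(1) by (auto simp: s_def strict_mono_o)
  have lim: "(\<lambda>n. x (s n)) \<longlonglongrightarrow> l" "(\<lambda>n. \<xi> (s n)) \<longlonglongrightarrow> \<xi>'" "(\<lambda>n. \<gamma> (s n)) \<longlonglongrightarrow> 0"
    using LIMSEQ_subseq_LIMSEQ[OF r(2) q(1)] q(2) LIMSEQ_subseq_LIMSEQ[OF \<gamma> s] by (auto simp: s_def o_def)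
  have glim: "(\<lambda>n. grad (x (s n))) \<longlonglongrightarrow> grad l"
    using continuous_on_tendsto_compose[OF assms(2) lim(1)] by simp
  have \<xi>': "\<xi>' \<in> subdifferential P2 l"
    using \<xi> by (intro subdifferential_closed_graph[OF assms(4) lim(1,2)])
  obtain z0 where z0: "P1 z0 - P2 l - \<xi>' \<bullet> (z0 - l) < \<sigma>" using assms(8)[OF l \<xi>'] by blast
  have "0 \<le> grad l \<bullet> (z - l)" if "z \<in> convex_approx P1 P2 \<sigma> l \<xi>'" for z
    using limit_minimizes_linearization[OF assms(3,4) lim(1,2) glim lim(3) min z0 that] .
  then show "stationary_point grad P1 P2 \<sigma> l"
    by (rule stationary_point_if_minimizes_linearization[OF assms(3) l \<xi>' z0])
qed

end
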